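(* For every integer $k>0$, there is a Las Vegas probabilistic finite automaton with $2\cdot 2^k$ states that recognizes $\mathtt{MODXOR}_k$ with success probability $1/2$.
   Context: For $k>0$, $\mathtt{MODXOR}_k\subseteq\{0,1\}^*$ is the set of strings of the form $w_0\,x_1\,u_1\,x_2\,u_2\cdots x_m\,u_m$ where $m>0$, $w_0\in\{0,1\}^*$ has length less than $2k$, each $x_i\in\{0,1\}$, each $u_i\in\{0,1\}^{2k-1}$, and $x_1\oplus\cdots\oplus x_m=1$. A probabilistic finite automaton (PFA) has a finite state set, an initial probability distribution, and a column-stochastic transition matrix for each input symbol (optionally also for a right end-marker read after the input). A Las Vegas PFA has its states partitioned into accepting, rejecting and neutral ("don't know") states; it recognizes $L$ with success probability $p$ if for every input $w$ it ends in a state giving the wrong answer with probability $0$ and in a state giving the correct answer ($w\in L$ or $w\notin L$) with probability at least $p$. *)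

theory Defs
  imports Complex_Main "Jordan_Normal_Form.Matrix"
begin

text \<open>Letters 0 and 1 are the booleans; each pair in the list \<open>bs\<close> is a block $(x_i, u_i)$,
  and \<open>\<noteq>\<close> on booleans is exclusive or.\<close>

definition MODXOR :: "nat \<Rightarrow> bool list set" where
  "MODXOR k = {w0 @ concat (map (\<lambda>(x, u). x # u) bs) | w0 bs.
     length w0 < 2 * k \<and> bs \<noteq> [] \<and> (\<forall>(x, u) \<in> set bs. length u = 2 * k - 1) \<and>
     foldr (\<noteq>) (map fst bs) False}"

definition prob_vec :: "nat \<Rightarrow> real vec \<Rightarrow> bool" where
  "prob_vec n v \<longleftrightarrow> v \<in> carrier_vec n \<and> (\<forall>i<n. 0 \<le> v $ i) \<and> (\<Sum>i<n. v $ i) = 1"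

definition col_stochastic :: "nat \<Rightarrow> real mat \<Rightarrow> bool" where
  "col_stochastic n A \<longleftrightarrow> A \<in> carrier_mat n n \<and> (\<forall>j<n. prob_vec n (col A j))"

text \<open>The states of an automaton \<open>M\<close> are the matrix indices \<open>{..<num_states M}\<close>.
  The end-marker matrix is \<open>None\<close> for an automaton that reads no right end-marker.\<close>

record 'a pfa =
  num_states :: nat
  init_dist :: "real vec"
  trans_mat :: "'a \<Rightarrow> real mat"
  end_mat :: "real mat option"

definition is_pfa :: "('a, 'z) pfa_scheme \<Rightarrow> bool" where
  "is_pfa M \<longleftrightarrow>
     prob_vec (num_states M) (init_dist M) \<and>
     (\<forall>a. col_stochastic (num_states M) (trans_mat M a)) \<and>
     (\<forall>E. end_mat M = Some E \<longrightarrow> col_stochastic (num_states M) E)"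

definition final_dist :: "('a, 'z) pfa_scheme \<Rightarrow> 'a list \<Rightarrow> real vec" where
  "final_dist M w =
     (let v = foldl (\<lambda>v a. trans_mat M a *\<^sub>v v) (init_dist M) w
      in case end_mat M of None \<Rightarrow> v | Some E \<Rightarrow> E *\<^sub>v v)"

definition final_prob :: "('a, 'z) pfa_scheme \<Rightarrow> 'a list \<Rightarrow> nat set \<Rightarrow> real" where
  "final_prob M w S = (\<Sum>q\<in>S. final_dist M w $ q)"

record 'a lv_pfa = "'a pfa" +
  accepting :: "nat set"
  rejecting :: "nat set"
  neutral :: "nat set"

definition is_lv_pfa :: "'a lv_pfa \<Rightarrow> bool" where
  "is_lv_pfa M \<longleftrightarrow> is_pfa M \<and>
     accepting M \<union> rejecting M \<union> neutral M = {..<num_states M} \<and>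
     accepting M \<inter> rejecting M = {} \<and>
     accepting M \<inter> neutral M = {} \<and>
     rejecting M \<inter> neutral M = {}"

definition lv_recognizes :: "'a lv_pfa \<Rightarrow> 'a list set \<Rightarrow> real \<Rightarrow> bool" where
  "lv_recognizes M L p \<longleftrightarrow>
     (\<forall>w. (w \<in> L \<longrightarrow> final_prob M w (rejecting M) = 0 \<and> p \<le> final_prob M w (accepting M)) \<and>
          (w \<notin> L \<longrightarrow> final_prob M w (accepting M) = 0 \<and> p \<le> final_prob M w (rejecting M)))"

end

theory Submission imports Defs begin

text \<open>A word \<open>w\<close> lies in \<open>MODXOR k\<close> iff the exclusive or of the letters whose distance to the right
  end of \<open>w\<close> is a multiple of \<open>2 * k\<close> is 1, so one parity for each residue class of positions modulo
  \<open>2 * k\<close> suffices to recognize it. The automaton guesses with a fair coin whether to store the \<open>k\<close>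
  parities of the even or of the odd residue classes, in a cyclic register of \<open>k\<close> bits; a single
  phase bit, toggled at every letter, tells whether the class of the current position is stored.
  The two guesses are active at complementary times, so exactly one of them knows the answer.\<close>

section \<open>Two equiprobable deterministic runs\<close>

lemma prob_vec_unit_vec:
  assumes "i < n"
  shows "prob_vec n (unit_vec n i)"
  using assms by (auto simp: prob_vec_def unit_vec_def sum.delta)

definition det_mat :: "nat \<Rightarrow> (nat \<Rightarrow> nat) \<Rightarrow> real mat" where
  "det_mat n f = mat n n (\<lambda>(i, j). if i = f j then 1 else 0)"

lemma det_mat_carrier: "det_mat n f \<in> carrier_mat n n"
  by (simp add: det_mat_def)

lemma col_det_mat:
  assumes "j < n" "f j < n"
  shows "col (det_mat n f) j = unit_vec n (f j)"
  using assms by (intro eq_vecI) (auto simp: det_mat_def unit_vec_def)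

lemma col_stochastic_det_mat:
  assumes "\<And>j. j < n \<Longrightarrow> f j < n"
  shows "col_stochastic n (det_mat n f)"
  using assms by (simp add: col_stochastic_def det_mat_carrier col_det_mat prob_vec_unit_vec)

definition half_half :: "nat \<Rightarrow> nat \<Rightarrow> nat \<Rightarrow> real vec" where
  "half_half n i j = (1/2) \<cdot>\<^sub>v (unit_vec n i + unit_vec n j)"

lemma prob_vec_half_half:
  assumes "i < n" "j < n"
  shows "prob_vec n (half_half n i j)"
proof -
  have "(\<Sum>l<n. half_half n i j $ l)
      = (1/2) * ((\<Sum>l<n. unit_vec n i $ l) + (\<Sum>l<n. unit_vec n j $ l))"
    by (simp add: half_half_def sum.distrib flip: sum_divide_distrib)
  also have "\<dots> = 1"
    using prob_vec_unit_vec[OF assms(1)] prob_vec_unit_vec[OF assms(2)]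
    by (simp add: prob_vec_def)
  finally show ?thesis
    by (simp add: prob_vec_def half_half_def unit_vec_def)
qed

lemma det_mat_half_half:
  assumes "\<And>j. j < n \<Longrightarrow> f j < n" "i < n" "j < n"
  shows "det_mat n f *\<^sub>v half_half n i j = half_half n (f i) (f j)"
proof -
  have "det_mat n f *\<^sub>v unit_vec n l = unit_vec n (f l)" if "l < n" for l
    using that assms(1)[OF that]
    by (intro eq_vecI) (auto simp: det_mat_def scalar_prod_right_unit index_unit_vec)
  then show ?thesis
    using assms(2,3)
    by (simp add: half_half_def mult_mat_vec[OF det_mat_carrier]
        mult_add_distrib_mat_vec[OF det_mat_carrier])
qed

lemma sum_half_half:
  assumes "A \<subseteq> {..<n}" "i < n" "j < n"
  shows "(\<Sum>q\<in>A. half_half n i j $ q) = (of_bool (i \<in> A) + of_bool (j \<in> A)) / 2"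
proof -
  have "finite A"
    using assms(1) finite_subset by blast
  moreover have "half_half n i j $ q = ((if q = i then 1 else 0) + (if q = j then 1 else 0)) / 2"
    if "q \<in> A" for q
    using that assms by (auto simp: half_half_def unit_vec_def)
  then have "(\<Sum>q\<in>A. half_half n i j $ q)
      = (\<Sum>q\<in>A. ((if q = i then 1 else 0) + (if q = j then 1 else 0)) / 2)"
    by (rule sum.cong[OF refl])
  ultimately show ?thesis
    by (simp add: sum.distrib flip: sum_divide_distrib)
qed

text \<open>Transition matrices act linearly, so each half of the initial mass follows its own
  deterministic run and the only randomness is the initial coin. What remains to choose is a
  deterministic step on a finite set of any type.\<close>

lemma lv_pfa_of_two_runs:
  fixes \<delta> :: "'s \<Rightarrow> 'a \<Rightarrow> 's"
  assumes "finite S" and closed: "\<And>s a. s \<in> S \<Longrightarrow> \<delta> s a \<in> S"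
    and "s0 \<in> S" "s1 \<in> S" "A \<subseteq> S" "R \<subseteq> S" "A \<inter> R = {}"
  obtains M :: "'a lv_pfa" where "is_lv_pfa M" "num_states M = card S"
    "\<And>w. final_prob M w (accepting M) =
       (of_bool (foldl \<delta> s0 w \<in> A) + of_bool (foldl \<delta> s1 w \<in> A)) / 2"
    "\<And>w. final_prob M w (rejecting M) =
       (of_bool (foldl \<delta> s0 w \<in> R) + of_bool (foldl \<delta> s1 w \<in> R)) / 2"
proof -
  define n where "n = card S"
  obtain g where g: "bij_betw g S {..<n}"
    using ex_bij_betw_finite_nat[OF \<open>finite S\<close>] by (auto simp: n_def lessThan_atLeast0)
  define h where "h = inv_into S g"
  have inj: "inj_on g S" and img: "g ` S = {..<n}"
    using g by (auto simp: bij_betw_def)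
  have g_less: "g s < n" if "s \<in> S" for s
    using that img by auto
  have hg: "h (g s) = s" if "s \<in> S" for s
    using that inj by (simp add: h_def)
  have h_in: "h i \<in> S" if "i < n" for i
    using that img by (auto simp: h_def intro: inv_into_into)
  define f where "f a i = g (\<delta> (h i) a)" for a i
  have f_less: "f a i < n" if "i < n" for a i
    using that by (simp add: f_def g_less closed h_in)
  define M :: "'a lv_pfa" where
    "M = \<lparr>num_states = n, init_dist = half_half n (g s0) (g s1),
      trans_mat = (\<lambda>a. det_mat n (f a)), end_mat = None,
      accepting = g ` A, rejecting = g ` R, neutral = g ` (S - A - R)\<rparr>"
  have disj: "g ` X \<inter> g ` Y = {}" if "X \<subseteq> S" "Y \<subseteq> S" "X \<inter> Y = {}" for X Y
    using that inj by (auto dest: inj_onD)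
  have "is_pfa M"
    using assms(3,4)
    by (simp add: is_pfa_def M_def prob_vec_half_half g_less col_stochastic_det_mat f_less)
  moreover have "g ` A \<union> g ` R \<union> g ` (S - A - R) = {..<n}"
    using img assms(5,6) by blast
  moreover have "g ` A \<inter> g ` R = {}" "g ` A \<inter> g ` (S - A - R) = {}" "g ` R \<inter> g ` (S - A - R) = {}"
    by (rule disj; use assms(5-7) in blast)+
  ultimately have lv: "is_lv_pfa M"
    by (simp add: is_lv_pfa_def M_def)
  have run: "foldl \<delta> s w \<in> S" if "s \<in> S" for s w
    using that by (induction w arbitrary: s) (auto simp: closed)
  have dist: "final_dist M w = half_half n (g (foldl \<delta> s0 w)) (g (foldl \<delta> s1 w))" for w
  proof (induction w rule: rev_induct)
    case Nil
    show ?case by (simp add: final_dist_def M_def)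
  next
    case (snoc a w)
    then show ?case
      using assms(3,4)
      by (simp add: final_dist_def M_def det_mat_half_half f_less g_less run) (simp add: f_def hg run)
  qed
  have prob: "final_prob M w (g ` X) =
      (of_bool (foldl \<delta> s0 w \<in> X) + of_bool (foldl \<delta> s1 w \<in> X)) / 2"
    if "X \<subseteq> S" for w X
  proof -
    have "g ` X \<subseteq> {..<n}"
      using that img by blast
    then show ?thesis
      using assms(3,4) that
      by (simp add: final_prob_def dist sum_half_half g_less run inj_on_image_mem_iff[OF inj])
  qed
  show thesis
    using that[OF lv] prob[OF assms(5)] prob[OF assms(6)] by (simp add: M_def n_def)
qed

section \<open>The language as a parity\<close>

text \<open>\<open>tap_parity k v d\<close> is the exclusive or of the letters of \<open>v\<close> at the indices \<open>i\<close> with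
  \<open>2 * k dvd d + i + 1\<close>; it is applied to reversed words, so that \<open>i + 1\<close> is the distance to the
  right end and \<open>d\<close> counts letters still to be read.\<close>

fun tap_parity :: "nat \<Rightarrow> bool list \<Rightarrow> nat \<Rightarrow> bool" where
  "tap_parity k [] d = False"
| "tap_parity k (a # v) d = (tap_parity k v (Suc d) \<noteq> (a \<and> 2 * k dvd Suc d))"

text \<open>The offset \<open>d\<close> matters only modulo \<open>2 * k\<close>; this is what makes
  a cyclic register possible.\<close>

lemma tap_parity_period: "tap_parity k v (d + 2 * k) = tap_parity k v d"
proof (induction v arbitrary: d)
  case (Cons a v)
  have "2 * k dvd Suc (d + 2 * k) \<longleftrightarrow> 2 * k dvd Suc d"
    by (metis add_Suc dvd_add_left_iff dvd_refl)
  then show ?case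
    using Cons.IH[of "Suc d"] by simp
qed simp

text \<open>The letters of \<open>u\<close> are tested at \<open>d + 1\<close> up to
  \<open>d + length u\<close>, all positive and below \<open>2 * k\<close>, so none of them
  counts.\<close>

lemma tap_parity_append_short:
  assumes "d + length u < 2 * k"
  shows "tap_parity k (u @ v) d = tap_parity k v (d + length u)"
  using assms by (induction u arbitrary: d) (auto dest: dvd_imp_le)

text \<open>The letters of \<open>u\<close> bring the offset to \<open>2 * k - 1\<close>; there
  \<open>x\<close> is counted, and the offset wraps around to 0.\<close>

lemma tap_parity_block:
  assumes "k > 0" "length u = 2 * k - 1"
  shows "tap_parity k (u @ x # v) 0 = (tap_parity k v 0 \<noteq> x)"
  using assms tap_parity_append_short[of 0 u k "x # v"] tap_parity_period[of k v 0] by simp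

lemma foldr_xor: "foldr (\<noteq>) xs b = (foldr (\<noteq>) xs False \<noteq> b)"
  by (induction xs) auto

lemma tap_parity_blocks:
  assumes "k > 0" "length w0 < 2 * k" "\<forall>(x, u) \<in> set bs. length u = 2 * k - 1"
  shows "tap_parity k (rev (w0 @ concat (map (\<lambda>(x, u). x # u) bs))) 0
    = foldr (\<noteq>) (map fst bs) False"
  using assms(3)
proof (induction bs rule: rev_induct)
  case Nil
  show ?case
    using assms(2) tap_parity_append_short[of 0 "rev w0" k "[]"] by simp
next
  case (snoc b bs)
  obtain x u where b: "b = (x, u)" by force
  show ?case
    using snoc assms(1) tap_parity_block[of k "rev u" x] foldr_xor[of "map fst bs" x]
    by (simp add: b)
qed

text \<open>Blocks of length \<open>2 * k\<close> are cut off from the right end until fewer than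
  \<open>2 * k\<close> letters remain.\<close>

lemma block_decomposition:
  assumes "k > 0"
  obtains w0 bs where "w = w0 @ concat (map (\<lambda>(x, u). x # u) bs)" "length w0 < 2 * k"
    "\<forall>(x, u) \<in> set bs. length u = 2 * k - 1"
proof -
  have "\<exists>w0 bs. w = w0 @ concat (map (\<lambda>(x, u). x # u) bs) \<and> length w0 < 2 * k \<and>
    (\<forall>(x, u) \<in> set bs. length u = 2 * k - 1)"
  proof (induction w rule: length_induct)
    case (1 w)
    show ?case
    proof (cases "length w < 2 * k")
      case True
      then show ?thesis
        by (intro exI[of _ w] exI[of _ "[]"]) simp
    next
      case False
      define w' where "w' = take (length w - 2 * k) w"
      define c where "c = drop (length w - 2 * k) w"
      have w: "w = w' @ c" "length c = 2 * k" "length w' < length w"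
        using False assms by (auto simp: w'_def c_def)
      then obtain x u where c: "c = x # u"
        using assms by (cases c) auto
      obtain w0 bs where "w' = w0 @ concat (map (\<lambda>(x, u). x # u) bs)" "length w0 < 2 * k"
        "\<forall>(x, u) \<in> set bs. length u = 2 * k - 1"
        using 1 w(3) by blast
      then show ?thesis
        using w c by (intro exI[of _ w0] exI[of _ "bs @ [(x, u)]"]) auto
    qed
  qed
  then show thesis
    using that by blast
qed

text \<open>The parity depends on \<open>w\<close> alone, so any one decomposition decides
  membership.\<close>

lemma MODXOR_iff_tap_parity:
  assumes "k > 0"
  shows "w \<in> MODXOR k \<longleftrightarrow> tap_parity k (rev w) 0"
proof
  assume "w \<in> MODXOR k"
  then show "tap_parity k (rev w) 0"
    using tap_parity_blocks[OF assms] unfolding MODXOR_def by blast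
next
  assume *: "tap_parity k (rev w) 0"
  obtain w0 bs where bs: "w = w0 @ concat (map (\<lambda>(x, u). x # u) bs)" "length w0 < 2 * k"
    "\<forall>(x, u) \<in> set bs. length u = 2 * k - 1"
    using block_decomposition[OF assms] .
  then have "foldr (\<noteq>) (map fst bs) False"
    using * tap_parity_blocks[OF assms bs(2,3)] by simp
  \<comment> \<open>An empty exclusive or is \<open>False\<close>, so a true parity forces a
    block.\<close>
  moreover from this have "bs \<noteq> []"
    by auto
  ultimately show "w \<in> MODXOR k"
    using bs unfolding MODXOR_def by blast
qed

section \<open>The register automaton\<close>

fun reg_step :: "bool \<times> bool list \<Rightarrow> bool \<Rightarrow> bool \<times> bool list" where
  "reg_step (b, r) a = (\<not> b, if b then tl r @ [hd r \<noteq> a] else r)"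

text \<open>Cell \<open>i\<close> holds the parity of the class whose distances become multiples of
  \<open>2 * k\<close> after \<open>2 * i\<close> more letters, or \<open>2 * i + 1\<close> while
  the phase bit is off. With the bit on, the head is thus the answer, and its class is also that of
  the next letter.\<close>

lemma reg_run:
  assumes "k > 0"
  shows "foldl reg_step (b, replicate k False) w =
    (b \<noteq> odd (length w),
     map (\<lambda>i. tap_parity k (rev w) (2 * i + of_bool (b = odd (length w)))) [0..<k])"
proof (induction w rule: rev_induct)
  case Nil
  show ?case by (auto simp: map_replicate_const)
next
  case (snoc a w)
  let ?T = "tap_parity k (rev w)"
  show ?case
  proof (cases "b = odd (length w)")
    case True
    \<comment> \<open>Idle step: the letter is tested at odd numbers only, so it enters no stored
      parity and every offset drops by one.\<close>
    have "odd (Suc (2 * i))" for i :: nat by simp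
    then have "\<not> 2 * k dvd Suc (2 * i)" for i
      by (meson dvd_mult_left)
    then show ?thesis
      using snoc True by simp
  next
    case False
    obtain m where k: "k = Suc m"
      using assms by (cases k) auto
    \<comment> \<open>Active step: only the last cell, \<open>i = m\<close>, is tested at a multiple
      of \<open>2 * k\<close>, namely \<open>2 * k\<close> itself. By periodicity it is the old head
      combined with \<open>a\<close>.\<close>
    have "\<not> 2 * k dvd Suc (Suc (2 * i))" if "i < m" for i
      using that k by (auto dest: dvd_imp_le)
    then have "map (\<lambda>i. tap_parity k (a # rev w) (2 * i + 1)) [0..<k]
        = map (\<lambda>i. ?T (2 * Suc i)) [0..<m] @ [?T 0 \<noteq> a]"
      using tap_parity_period[of k "rev w" 0] by (simp add: k)
    also have "\<dots> = tl (map (\<lambda>i. ?T (2 * i)) [0..<k]) @ [hd (map (\<lambda>i. ?T (2 * i)) [0..<k]) \<noteq> a]"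
      by (simp add: k upt_conv_Cons map_Suc_upt[symmetric] del: upt_Suc)
    finally show ?thesis
      using snoc False by simp
  qed
qed

theorem theorem10:
  fixes k :: nat
  assumes "k > 0"
  shows "\<exists>M :: bool lv_pfa.
    is_lv_pfa M \<and> num_states M = 2 * 2 ^ k \<and> lv_recognizes M (MODXOR k) (1 / 2)"
proof -
  define S :: "(bool \<times> bool list) set" where "S = UNIV \<times> {r. length r = k}"
  \<comment> \<open>Only states with the phase bit on give an answer, read off the head; idle states
    are neutral.\<close>
  define A where "A = {s \<in> S. fst s \<and> hd (snd s)}"
  define R where "R = {s \<in> S. fst s \<and> \<not> hd (snd s)}"
  have lists: "{r :: bool list. length r = k} = {r. set r \<subseteq> UNIV \<and> length r = k}"
    by simp
  have "finite S"
    unfolding S_def lists by (intro finite_cartesian_product finite_lists_length_eq) auto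
  have card_S: "card S = 2 * 2 ^ k"
    unfolding S_def lists by (simp only: card_cartesian_product card_lists_length_eq finite) simp
  obtain M :: "bool lv_pfa" where M: "is_lv_pfa M" "num_states M = card S"
    "\<And>w. final_prob M w (accepting M) =
       (of_bool (foldl reg_step (False, replicate k False) w \<in> A)
        + of_bool (foldl reg_step (True, replicate k False) w \<in> A)) / 2"
    "\<And>w. final_prob M w (rejecting M) =
       (of_bool (foldl reg_step (False, replicate k False) w \<in> R)
        + of_bool (foldl reg_step (True, replicate k False) w \<in> R)) / 2"
    by (rule lv_pfa_of_two_runs[OF \<open>finite S\<close>, of reg_step "(False, replicate k False)"
          "(True, replicate k False)" A R])
      (use assms in \<open>auto simp: S_def A_def R_def\<close>)
  \<comment> \<open>The two starting phases differ, hence so do the phases after any word: exactly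
    one run answers, correctly and with mass 1/2.\<close>
  have prob: "final_prob M w (accepting M) = of_bool (w \<in> MODXOR k) / 2"
    "final_prob M w (rejecting M) = of_bool (w \<notin> MODXOR k) / 2" for w
    using assms
    by (simp_all add: M(3,4) reg_run A_def R_def S_def hd_map MODXOR_iff_tap_parity)
  have "lv_recognizes M (MODXOR k) (1 / 2)"
    by (simp add: lv_recognizes_def prob)
  then show ?thesis
    using M(1,2) card_S by auto
qed

end
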